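(* For all integers $k,a\ge 0$, the following identities hold in $\mathbf{U}^\imath$: $$B_{\bar 1}^{(2k)}B_{\bar 1}^{(2a)}=\begin{bmatrix}2k+2a\\2k\end{bmatrix}\Big(B_{\bar 1}^{(2k+2a)}+\sum_{\ell=1}^{k}\prod_{m=1}^{\ell}\frac{[2a-2m+2][2k-2m+2]}{[2k+2a-2m+1][2m]}(q\varsigma)^{\ell}B_{\bar 1}^{(2k+2a-2\ell)}\Big),$$ $$B_{\bar 1}^{(2k)}B_{\bar 1}^{(2a+1)}=\begin{bmatrix}2k+2a+1\\2k\end{bmatrix}\Big(B_{\bar 1}^{(2k+2a+1)}+\sum_{\ell=1}^{k}\prod_{m=1}^{\ell}\frac{[2a-2m+2][2k-2m+2]}{[2k+2a-2m+3][2m]}(q\varsigma)^{\ell}B_{\bar 1}^{(2k+2a-2\ell+1)}\Big),$$ $$B_{\bar 1}^{(2k+1)}B_{\bar 1}^{(2a)}=\begin{bmatrix}2k+2a+1\\2k+1\end{bmatrix}\Big(B_{\bar 1}^{(2k+2a+1)}+\sum_{\ell=1}^{k}\prod_{m=1}^{\ell}\frac{[2a-2m+2][2k-2m+2]}{[2k+2a-2m+3][2m]}(q\varsigma)^{\ell}B_{\bar 1}^{(2k+2a-2\ell+1)}\Big),$$ $$B_{\bar 1}^{(2k+1)}B_{\bar 1}^{(2a+1)}=\begin{bmatrix}2k+2a+2\\2k+1\end{bmatrix}\Big(B_{\bar 1}^{(2k+2a+2)}+\sum_{\ell=1}^{k+1}\Big(\frac{[2k+2a-2\ell+2][2k-2\ell+2]}{[2k+2a+2][2k+2]}+\frac{[2k+2a-2\ell+3]^2[2\ell]}{[2k+2a+2][2a-2\ell+2][2k+2]}\Big)\cdot\prod_{m=1}^{\ell}\frac{[2a-2m+2][2k-2m+4]}{[2k+2a-2m+3][2m]}(q\varsigma)^{\ell}B_{\bar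 1}^{(2k+2a-2\ell+2)}\Big).$$ In the last identity, the denominator $[2a-2\ell+2]$ is understood to be cancelled against the factor $[2a-2m+2]$ with $m=\ell$ of the product that it multiplies (this matters only when $\ell=a+1$, where $[2a-2\ell+2]=0$).
   Context: The base field is $\mathbb{Q}(q)$, $q$ an indeterminate, and $\varsigma\in\mathbb{Q}(q)^\times$ is a fixed parameter. Quantum integers: $[n]=\frac{q^n-q^{-n}}{q-q^{-1}}$ for $n\in\mathbb{Z}$, $[n]!=[1][2]\cdots[n]$ (with $[0]!=1$), and $\begin{bmatrix}n\\k\end{bmatrix}=\frac{[n]!}{[k]!\,[n-k]!}$ for $0\le k\le n$. Let $\mathbf{U}$ be the quantum group of $\mathfrak{sl}_2$ over $\mathbb{Q}(q)$ with generators $E,F,K^{\pm1}$ and relations $KE=q^2EK$, $KF=q^{-2}FK$, $EF-FE=\frac{K-K^{-1}}{q-q^{-1}}$. Let $B=F+\varsigma EK^{-1}\in\mathbf{U}$, and let $\mathbf{U}^\imath=\mathbb{Q}(q)[B]$ be the subalgebra of $\mathbf{U}$ generated by $B$, which is a polynomial algebra in $B$. The $\imath$-divided powers of parity $\bar 1$ are defined for $n\in\mathbb{N}=\{0,1,2,\dots\}$ by $$B_{\bar 1}^{(n)}=\frac{1}{[n]!}\begin{cases}B\prod_{j=1}^{k}(B^2-q\varsigma[2j-1]^2)& n=2k+1,\\ \prod_{j=1}^{k}(B^2-q\varsigma[2j-1]^2)& n=2k.\end{cases}$$ Empty sums are $0$ and empty products are $1$. *)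

theory Defs
  imports Complex_Main "HOL-Library.Poly_Mapping" "HOL-Computational_Algebra.Polynomial"
    "HOL-Computational_Algebra.Fraction_Field"
begin

section \<open>Quantum integers\<close>

type_synonym Qq = "rat poly fract"

definition q :: Qq where
  "q = Fract [:0, 1:] 1"

definition qint :: "int \<Rightarrow> Qq" where
  "qint n = (q powi n - q powi (- n)) / (q - inverse q)"

definition qfact :: "nat \<Rightarrow> Qq" where
  "qfact n = (\<Prod>i=1..n. qint (int i))"

text \<open>Only meaningful for \<open>k \<le> n\<close>, because of the truncated subtraction.\<close>

definition qbinom :: "nat \<Rightarrow> nat \<Rightarrow> Qq" where
  "qbinom n k = qfact n / (qfact k * qfact (n - k))"


section \<open>The free algebra on four generators\<close>

datatype gen = Gen_E | Gen_F | Gen_K | Gen_Kinv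

text \<open>Words are the free monoid, written additively so that the convolution product of
  finitely supported functions on words is the product of the free algebra.\<close>

datatype gword = Word (letters: "gen list")

instantiation gword :: monoid_add
begin

definition zero_gword :: gword where
  "0 = Word []"

definition plus_gword :: "gword \<Rightarrow> gword \<Rightarrow> gword" where
  "v + w = Word (letters v @ letters w)"

instance
  by standard (simp_all add: zero_gword_def plus_gword_def)

end

type_synonym free_alg = "gword \<Rightarrow>\<^sub>0 Qq"

definition gen :: "gen \<Rightarrow> free_alg" where
  "gen x = Poly_Mapping.single (Word [x]) 1"

definition scalar :: "Qq \<Rightarrow> free_alg" where
  "scalar c = Poly_Mapping.single 0 c"

lemma scalar_mult: "scalar (c * d) = scalar c * scalar d"
  by (simp add: scalar_def mult_single)

lemma scalar_add: "scalar (c + d) = scalar c + scalar d"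
  by (simp add: scalar_def single_add)

lemma scalar_one: "scalar 1 = 1"
  by (simp add: scalar_def)

lemma poly_mapping_as_sum:
  "f = (\<Sum>w\<in>Poly_Mapping.keys f. Poly_Mapping.single w (Poly_Mapping.lookup f w))"
proof (rule poly_mapping_eqI)
  fix v
  have "(\<Sum>w\<in>Poly_Mapping.keys f. Poly_Mapping.lookup f w when w = v) = Poly_Mapping.lookup f v"
    by (cases "v \<in> Poly_Mapping.keys f") (auto simp: when_def in_keys_iff)
  then show "Poly_Mapping.lookup f v = Poly_Mapping.lookup
      (\<Sum>w\<in>Poly_Mapping.keys f. Poly_Mapping.single w (Poly_Mapping.lookup f w)) v"
    by (simp add: lookup_sum lookup_single)
qed

lemma scalar_commute:
  fixes f :: free_alg
  shows "f * scalar c = scalar c * f"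
proof -
  have *: "Poly_Mapping.single w d * scalar c = scalar c * Poly_Mapping.single w d" for w d
    by (simp add: scalar_def mult_single mult.commute)
  let ?g = "\<Sum>w\<in>Poly_Mapping.keys f. Poly_Mapping.single w (Poly_Mapping.lookup f w)"
  have "?g * scalar c = scalar c * ?g"
    by (simp only: sum_distrib_left sum_distrib_right *)
  then show ?thesis
    by (simp only: poly_mapping_as_sum[of f, symmetric])
qed


section \<open>The quantum group of $sl_2$\<close>

definition uq_relations :: "free_alg set" where
  "uq_relations = {
     gen Gen_K * gen Gen_Kinv - 1,
     gen Gen_Kinv * gen Gen_K - 1,
     gen Gen_K * gen Gen_E - scalar (q\<^sup>2) * gen Gen_E * gen Gen_K,
     gen Gen_K * gen Gen_F - scalar (q powi (-2)) * gen Gen_F * gen Gen_K,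
     gen Gen_E * gen Gen_F - gen Gen_F * gen Gen_E
       - scalar (inverse (q - inverse q)) * (gen Gen_K - gen Gen_Kinv)}"

text \<open>The two-sided ideal generated by the relations.\<close>

inductive_set uq_ideal :: "free_alg set" where
  zero: "0 \<in> uq_ideal"
| relation: "r \<in> uq_relations \<Longrightarrow> a * r * b \<in> uq_ideal"
| add: "x \<in> uq_ideal \<Longrightarrow> y \<in> uq_ideal \<Longrightarrow> x + y \<in> uq_ideal"

lemma uq_ideal_mult:
  assumes "x \<in> uq_ideal"
  shows "a * x * b \<in> uq_ideal"
  using assms
proof induction
  case zero
  then show ?case by (simp add: uq_ideal.zero)
next
  case (relation r c d)
  then have "(a * c) * r * (d * b) \<in> uq_ideal" by (rule uq_ideal.relation)
  then show ?case by (simp add: mult.assoc)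
next
  case (add x y)
  then show ?case by (simp add: distrib_left distrib_right uq_ideal.add)
qed

lemma uq_ideal_mult_left: "x \<in> uq_ideal \<Longrightarrow> a * x \<in> uq_ideal"
  using uq_ideal_mult[of x a 1] by simp

lemma uq_ideal_mult_right: "x \<in> uq_ideal \<Longrightarrow> x * b \<in> uq_ideal"
  using uq_ideal_mult[of x 1 b] by simp

lemma uq_ideal_uminus: "x \<in> uq_ideal \<Longrightarrow> - x \<in> uq_ideal"
  using uq_ideal_mult_left[of x "-1"] by simp

lemma uq_ideal_diff: "x \<in> uq_ideal \<Longrightarrow> y \<in> uq_ideal \<Longrightarrow> x - y \<in> uq_ideal"
  using uq_ideal.add[of x "- y"] uq_ideal_uminus[of y] by simp

definition uq_equiv :: "free_alg \<Rightarrow> free_alg \<Rightarrow> bool" where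
  "uq_equiv x y \<longleftrightarrow> x - y \<in> uq_ideal"

lemma uq_equiv_equivp: "equivp uq_equiv"
proof (rule equivpI)
  show "reflp uq_equiv"
    by (auto simp: reflp_def uq_equiv_def uq_ideal.zero)
  show "symp uq_equiv"
    unfolding symp_def uq_equiv_def
  proof (intro allI impI)
    fix x y assume "x - y \<in> uq_ideal"
    then have "- (x - y) \<in> uq_ideal" by (rule uq_ideal_uminus)
    then show "y - x \<in> uq_ideal" by simp
  qed
  show "transp uq_equiv"
    unfolding transp_def uq_equiv_def
  proof (intro allI impI)
    fix x y z assume "x - y \<in> uq_ideal" "y - z \<in> uq_ideal"
    then have "(x - y) + (y - z) \<in> uq_ideal" by (rule uq_ideal.add)
    then show "x - z \<in> uq_ideal" by simp
  qed
qed

lemma uq_equiv_add: "uq_equiv x x' \<Longrightarrow> uq_equiv y y' \<Longrightarrow> uq_equiv (x + y) (x' + y')"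
  unfolding uq_equiv_def add_diff_add by (rule uq_ideal.add)

lemma uq_equiv_diff: "uq_equiv x x' \<Longrightarrow> uq_equiv y y' \<Longrightarrow> uq_equiv (x - y) (x' - y')"
  unfolding uq_equiv_def using uq_ideal_diff[of "x - x'" "y - y'"]
  by (simp add: algebra_simps)

lemma uq_equiv_uminus: "uq_equiv x x' \<Longrightarrow> uq_equiv (- x) (- x')"
  unfolding uq_equiv_def using uq_ideal_uminus[of "x - x'"] by simp

lemma uq_equiv_mult: "uq_equiv x x' \<Longrightarrow> uq_equiv y y' \<Longrightarrow> uq_equiv (x * y) (x' * y')"
proof -
  assume "uq_equiv x x'" "uq_equiv y y'"
  then have "x * (y - y') + (x - x') * y' \<in> uq_ideal"
    unfolding uq_equiv_def by (intro uq_ideal.add uq_ideal_mult_left uq_ideal_mult_right)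
  then show "uq_equiv (x * y) (x' * y')"
    by (simp add: uq_equiv_def algebra_simps)
qed

text \<open>The ideal is proper: the character \<open>E, F \<mapsto> 0\<close>, \<open>K\<^sup>\<plusminus>\<^sup>1 \<mapsto> 1\<close> of the free algebra kills
  the relations.\<close>

definition word_char :: "gword \<Rightarrow> Qq" where
  "word_char w = (if set (letters w) \<subseteq> {Gen_K, Gen_Kinv} then 1 else 0)"

definition counit :: "free_alg \<Rightarrow> Qq" where
  "counit f = (\<Sum>w\<in>Poly_Mapping.keys f. Poly_Mapping.lookup f w * word_char w)"

lemma counit_superset:
  assumes "finite A" "Poly_Mapping.keys f \<subseteq> A"
  shows "counit f = (\<Sum>w\<in>A. Poly_Mapping.lookup f w * word_char w)"
  unfolding counit_def
  by (rule sum.mono_neutral_left) (use assms in \<open>auto simp: in_keys_iff\<close>)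

lemma counit_add: "counit (f + g) = counit f + counit g"
proof -
  let ?A = "Poly_Mapping.keys f \<union> Poly_Mapping.keys g"
  have "counit (f + g) = (\<Sum>w\<in>?A. Poly_Mapping.lookup (f + g) w * word_char w)"
    by (rule counit_superset) (auto simp: keys_add)
  also have "\<dots> = (\<Sum>w\<in>?A. Poly_Mapping.lookup f w * word_char w)
      + (\<Sum>w\<in>?A. Poly_Mapping.lookup g w * word_char w)"
    by (simp add: lookup_add distrib_right sum.distrib)
  also have "\<dots> = counit f + counit g"
    by (simp add: counit_superset[of ?A f] counit_superset[of ?A g])
  finally show ?thesis .
qed

lemma counit_zero [simp]: "counit 0 = 0"
  by (simp add: counit_def)

lemma counit_diff: "counit (f - g) = counit f - counit g"
  using counit_add[of "f - g" g] by simp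

lemma counit_sum: "counit (sum h A) = (\<Sum>i\<in>A. counit (h i))"
  by (induction A rule: infinite_finite_induct) (simp_all add: counit_add)

lemma counit_single: "counit (Poly_Mapping.single w c) = c * word_char w"
  by (simp add: counit_superset[of "{w}"])

lemma counit_mult: "counit (f * g) = counit f * counit g"
proof -
  have *: "counit (Poly_Mapping.single v c * Poly_Mapping.single w d)
      = counit (Poly_Mapping.single v c) * counit (Poly_Mapping.single w d)" for v w c d
    by (simp add: mult_single counit_single word_char_def plus_gword_def)
  let ?mono = "\<lambda>h w. Poly_Mapping.single w (Poly_Mapping.lookup h w) :: free_alg"
  have "counit (sum (?mono f) (Poly_Mapping.keys f) * sum (?mono g) (Poly_Mapping.keys g))
      = counit (sum (?mono f) (Poly_Mapping.keys f)) * counit (sum (?mono g) (Poly_Mapping.keys g))"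
    by (simp only: sum_product counit_sum *)
  then show ?thesis
    by (simp only: poly_mapping_as_sum[of f, symmetric] poly_mapping_as_sum[of g, symmetric])
qed

lemma counit_one: "counit 1 = 1"
proof -
  have "word_char 0 = 1"
    by (simp add: word_char_def zero_gword_def)
  then show ?thesis
    using counit_single[of 0 1] by simp
qed

lemma counit_relation: "r \<in> uq_relations \<Longrightarrow> counit r = 0"
  by (auto simp: uq_relations_def counit_diff counit_mult counit_one gen_def counit_single
      word_char_def)

lemma counit_ideal: "x \<in> uq_ideal \<Longrightarrow> counit x = 0"
  by (induction rule: uq_ideal.induct) (simp_all add: counit_mult counit_add counit_relation)

quotient_type uq = free_alg / uq_equiv
  by (rule uq_equiv_equivp)

instantiation uq :: ring_1
begin

lift_definition zero_uq :: uq is 0 .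
lift_definition one_uq :: uq is 1 .
lift_definition plus_uq :: "uq \<Rightarrow> uq \<Rightarrow> uq" is "(+)" by (rule uq_equiv_add)
lift_definition minus_uq :: "uq \<Rightarrow> uq \<Rightarrow> uq" is "(-)" by (rule uq_equiv_diff)
lift_definition uminus_uq :: "uq \<Rightarrow> uq" is uminus by (rule uq_equiv_uminus)
lift_definition times_uq :: "uq \<Rightarrow> uq \<Rightarrow> uq" is "(*)" by (rule uq_equiv_mult)

instance
proof
  fix a b c :: uq
  note refl = equivp_reflp[OF uq_equiv_equivp]
  show "a * b * c = a * (b * c)" by transfer (simp add: mult.assoc refl)
  show "1 * a = a" by transfer (simp add: refl)
  show "a * 1 = a" by transfer (simp add: refl)
  show "a + b + c = a + (b + c)" by transfer (simp add: add.assoc refl)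
  show "a + b = b + a" by transfer (simp add: add.commute refl)
  show "0 + a = a" by transfer (simp add: refl)
  show "- a + a = 0" by transfer (simp add: refl)
  show "a - b = a + - b" by transfer (simp add: refl)
  show "(a + b) * c = a * c + b * c" by transfer (simp add: distrib_right refl)
  show "a * (b + c) = a * b + a * c" by transfer (simp add: distrib_left refl)
  show "(0::uq) \<noteq> 1"
  proof transfer
    have "counit (0 - 1) \<noteq> 0" by (simp only: counit_diff counit_one counit_zero)
    then show "\<not> uq_equiv 0 1" using counit_ideal unfolding uq_equiv_def by blast
  qed
qed

end

lift_definition uq_scale :: "Qq \<Rightarrow> uq \<Rightarrow> uq" (infixr \<open>*\<^sub>q\<close> 75) is "\<lambda>c x. scalar c * x"
  by (rule uq_equiv_mult) (auto intro: equivp_reflp[OF uq_equiv_equivp])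

lemma uq_vector_space: "vector_space uq_scale"
proof
  fix a b :: Qq and x y :: uq
  note refl = equivp_reflp[OF uq_equiv_equivp]
  show "a *\<^sub>q (x + y) = a *\<^sub>q x + a *\<^sub>q y" by transfer (simp add: distrib_left refl)
  show "(a + b) *\<^sub>q x = a *\<^sub>q x + b *\<^sub>q x"
    by transfer (simp add: scalar_add distrib_right refl)
  show "a *\<^sub>q b *\<^sub>q x = (a * b) *\<^sub>q x" by transfer (simp add: scalar_mult mult.assoc refl)
  show "1 *\<^sub>q x = x" by transfer (simp add: scalar_one refl)
qed

lemma uq_scale_mult_left: "(c *\<^sub>q x) * y = c *\<^sub>q (x * y)"
  by transfer (simp add: mult.assoc equivp_reflp[OF uq_equiv_equivp])

lemma uq_scale_mult_right: "x * (c *\<^sub>q y) = c *\<^sub>q (x * y)"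
proof transfer
  fix x y c
  have "x * (scalar c * y) = scalar c * (x * y)"
    by (simp only: mult.assoc[symmetric] scalar_commute[of x])
  then show "uq_equiv (x * (scalar c * y)) (scalar c * (x * y))"
    by (simp add: equivp_reflp[OF uq_equiv_equivp])
qed

lift_definition uE :: uq is "gen Gen_E" .
lift_definition uF :: uq is "gen Gen_F" .
lift_definition uK :: uq is "gen Gen_K" .
lift_definition uKinv :: uq is "gen Gen_Kinv" .

lemma uq_defining_relations:
  "uK * uKinv = 1"
  "uKinv * uK = 1"
  "uK * uE = q\<^sup>2 *\<^sub>q (uE * uK)"
  "uK * uF = (q powi (-2)) *\<^sub>q (uF * uK)"
  "uE * uF - uF * uE = inverse (q - inverse q) *\<^sub>q (uK - uKinv)"
proof -
  have *: "r \<in> uq_relations \<Longrightarrow> r \<in> uq_ideal" for r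
    using uq_ideal.relation[of r 1 1] by simp
  show "uK * uKinv = 1" "uKinv * uK = 1" "uK * uE = q\<^sup>2 *\<^sub>q (uE * uK)"
    "uK * uF = (q powi (-2)) *\<^sub>q (uF * uK)"
    "uE * uF - uF * uE = inverse (q - inverse q) *\<^sub>q (uK - uKinv)"
    by (transfer; unfold uq_equiv_def; rule *; simp only: uq_relations_def mult.assoc insert_iff simp_thms)+
qed


section \<open>The subalgebra generated by $B$ and the divided powers of odd parity\<close>

definition uB :: "Qq \<Rightarrow> uq" where
  "uB \<sigma> = uF + \<sigma> *\<^sub>q (uE * uKinv)"

inductive_set Uiota :: "Qq \<Rightarrow> uq set" for \<sigma> :: Qq where
  B: "uB \<sigma> \<in> Uiota \<sigma>"
| one: "1 \<in> Uiota \<sigma>"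
| add: "x \<in> Uiota \<sigma> \<Longrightarrow> y \<in> Uiota \<sigma> \<Longrightarrow> x + y \<in> Uiota \<sigma>"
| scale: "x \<in> Uiota \<sigma> \<Longrightarrow> c *\<^sub>q x \<in> Uiota \<sigma>"
| mult: "x \<in> Uiota \<sigma> \<Longrightarrow> y \<in> Uiota \<sigma> \<Longrightarrow> x * y \<in> Uiota \<sigma>"

text \<open>The product is an ordered list product because \<open>uq\<close> is not commutative; its factors
  commute with each other, so the order is immaterial.\<close>

definition idiv_prod :: "Qq \<Rightarrow> nat \<Rightarrow> uq" where
  "idiv_prod \<sigma> k =
     (\<Prod>j\<leftarrow>[1..<k+1]. (uB \<sigma>)\<^sup>2 - (q * \<sigma> * (qint (2 * int j - 1))\<^sup>2) *\<^sub>q 1)"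

definition idiv :: "Qq \<Rightarrow> nat \<Rightarrow> uq" where
  "idiv \<sigma> n = inverse (qfact n) *\<^sub>q
     (if odd n then uB \<sigma> * idiv_prod \<sigma> (n div 2) else idiv_prod \<sigma> (n div 2))"

lemma idiv_in_Uiota: "idiv \<sigma> n \<in> Uiota \<sigma>"
proof -
  interpret vector_space uq_scale by (rule uq_vector_space)
  have diff: "x - c *\<^sub>q 1 \<in> Uiota \<sigma>" if "x \<in> Uiota \<sigma>" for x c
    using Uiota.add[OF that Uiota.scale[OF Uiota.one, of "- c"]] by simp
  have "prod_list (map (\<lambda>j. (uB \<sigma>)\<^sup>2 - f j *\<^sub>q 1) js) \<in> Uiota \<sigma>" for f and js :: "nat list"
    by (induction js)
       (auto simp: power2_eq_square intro!: diff Uiota.one Uiota.mult Uiota.B)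
  then have "idiv_prod \<sigma> k \<in> Uiota \<sigma>" for k
    by (simp add: idiv_prod_def)
  then show ?thesis
    by (auto simp: idiv_def intro!: Uiota.scale Uiota.mult Uiota.B)
qed

end

theory Submission
  imports Defs
begin

text \<open>Put \<open>t = q \<sigma>\<close> and let \<open>P k\<close> be the product of the \<open>B\<^sup>2 - t [2j-1]\<^sup>2\<close> for \<open>1 \<le> j \<le> k\<close>.
  Multiplying by \<open>B\<^sup>2\<close> sends \<open>P n\<close> to \<open>P (n+1) + t [2n+1]\<^sup>2 P n\<close>, so induction on \<open>k\<close> expands
  \<open>P k P a\<close> in the \<open>P (k+a-l)\<close>; the recursion of the coefficients is the identity
  \<open>[N][K] = [N-L][K-L] + [L][N+K-L]\<close>. The first three formulas are this expansion up to
  quantum factorials, and the last one is the expansion multiplied once more by \<open>B\<^sup>2\<close>.\<close>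

interpretation uq: vector_space uq_scale
  by (rule uq_vector_space)

section \<open>Powers of \<open>q\<close> and identities between quantum integers\<close>

lemma q_power: "q ^ n = Fract (monom 1 n) 1"
  by (induction n) (simp_all add: q_def One_fract_def monom_Suc monom_0 one_pCons)

lemma q_nonzero [simp]: "q \<noteq> 0"
  by (simp add: q_def Zero_fract_def eq_fract)

text \<open>\<open>q\<close> is transcendental over the rationals: \<open>q ^ m\<close> is the
  monomial of degree \<open>m\<close>, so a comparison of degrees decides the claim. Negative
  exponents reduce to this by inversion.\<close>

lemma q_powi_eq_1_iff [simp]: "q powi n = 1 \<longleftrightarrow> n = 0"
proof -
  have nat: "q ^ m = 1 \<longleftrightarrow> m = 0" for m :: nat
  proof -
    have "q ^ m = 1 \<longleftrightarrow> monom 1 m = (1 :: rat poly)"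
      by (simp add: q_power One_fract_def eq_fract)
    also have "\<dots> \<longleftrightarrow> m = 0"
      by (metis degree_1 degree_monom_eq monom_0 one_pCons one_neq_zero)
    finally show ?thesis .
  qed
  show ?thesis
    using nat[of "nat n"] nat[of "nat (- n)"] by (auto simp: power_int_def power_inverse)
qed

lemma q_minus_inverse_nonzero: "q - inverse q \<noteq> 0"
proof
  assume "q - inverse q = 0"
  then have "q powi 2 = 1"
    by (simp add: power2_eq_square field_simps)
  then show False
    by (subst (asm) q_powi_eq_1_iff) simp
qed

lemma qint_0 [simp]: "qint 0 = 0"
  by (simp add: qint_def)

lemma qint_eq_0_iff [simp]: "qint n = 0 \<longleftrightarrow> n = 0"
proof
  assume "qint n = 0"
  then have "q powi n - q powi (- n) = 0"
    by (simp only: qint_def divide_eq_0_iff q_minus_inverse_nonzero simp_thms)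
  then have "q powi (2 * n) = 1"
    by (metis add.right_inverse eq_iff_diff_eq_0 mult_2 power_int_0_right power_int_add q_nonzero)
  then show "n = 0"
    by (subst (asm) q_powi_eq_1_iff) simp
qed simp

lemma qint_mult:
  "qint m * qint n = (q powi (m + n) + q powi (- m - n) - q powi (m - n) - q powi (n - m))
     / (q - inverse q)\<^sup>2"
proof -
  have "(q powi m - q powi (- m)) * (q powi n - q powi (- n))
      = q powi (m + n) + q powi (- m - n) - q powi (m - n) - q powi (n - m)"
    by (simp add: algebra_simps flip: power_int_add)
  then show ?thesis
    by (simp add: qint_def power2_eq_square)
qed

text \<open>Needed to write the difference of two constants t[2n+1]^2 and t[c]^2 as a product, so
  that the expansion coefficients become products too.\<close>

lemma qint_square_diff: "(qint m)\<^sup>2 - (qint n)\<^sup>2 = qint (m - n) * qint (m + n)"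
  by (simp add: power2_eq_square[of "qint _"] qint_mult algebra_simps flip: diff_divide_distrib)

text \<open>After \<open>qint_mult\<close>, the powers of \<open>q\<close> with exponents m + n - 2l
  and its negative occur with opposite signs in the two products on the right and cancel.\<close>

lemma qint_mult_shift: "qint m * qint n = qint (m - l) * qint (n - l) + qint l * qint (m + n - l)"
  by (simp add: qint_mult algebra_simps flip: add_divide_distrib)

section \<open>Quantum factorials split into pairs of consecutive factors\<close>

lemma qfact_nonzero [simp]: "qfact n \<noteq> 0"
  by (simp add: qfact_def)

lemma qfact_Suc: "qfact (Suc n) = qfact n * qint (int n + 1)"
  by (simp add: qfact_def algebra_simps)

text \<open>Each index \<open>m\<close> accounts for one even and one odd factor at the top of the
  factorial. This pairing later turns products of odd quantum integers in denominators into
  quotients of factorials.\<close>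

lemma qfact_double_diff:
  assumes "l \<le> n"
  shows "qfact (2 * n) = qfact (2 * n - 2 * l)
     * (\<Prod>m=1..l. qint (2 * int n - 2 * int m + 2) * qint (2 * int n - 2 * int m + 1))"
  using assms
proof (induction l)
  case (Suc l)
  \<comment> \<open>\<open>Suc l \<le> n\<close> makes the truncated subtraction exact, so two more
    factors can be split off.\<close>
  then have "2 * n - 2 * l = Suc (Suc (2 * n - 2 * Suc l))"
    by simp
  then have "qfact (2 * n - 2 * l) = qfact (2 * n - 2 * Suc l)
      * (qint (2 * int n - 2 * int l - 1) * qint (2 * int n - 2 * int l))"
    using Suc.prems by (simp only: qfact_Suc) (simp add: algebra_simps of_nat_diff)
  with Suc show ?case
    by (simp add: algebra_simps)
qed simp

lemma qfact_double_Suc_diff: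
  assumes "l \<le> n"
  shows "qfact (2 * n + 1) = qfact (2 * n + 1 - 2 * l)
     * (\<Prod>m=1..l. qint (2 * int n - 2 * int m + 2) * qint (2 * int n - 2 * int m + 3))"
  using assms
proof (induction l)
  case (Suc l)
  then have "2 * n + 1 - 2 * l = Suc (Suc (2 * n + 1 - 2 * Suc l))"
    by simp
  then have "qfact (2 * n + 1 - 2 * l) = qfact (2 * n + 1 - 2 * Suc l)
      * (qint (2 * int n - 2 * int l) * qint (2 * int n - 2 * int l + 1))"
    using Suc.prems by (simp only: qfact_Suc) (simp add: algebra_simps of_nat_diff)
  with Suc show ?case
    by (simp add: algebra_simps)
qed simp

section \<open>Coefficients of the expansion of \<open>P k P a\<close>\<close>

text \<open>This is the coefficient of t^l \<open>P (k+a-l)\<close> in \<open>P k P a\<close>. The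
  parameters are integers, so that differences may become zero or negative without
  truncation.\<close>

definition idiv_coeff :: "int \<Rightarrow> int \<Rightarrow> nat \<Rightarrow> Qq" where
  "idiv_coeff k a l = (\<Prod>m=1..l. qint (2 * k + 2 * a - 2 * int m + 2)
     * (qint (2 * a - 2 * int m + 2) * qint (2 * k - 2 * int m + 2)) / qint (2 * int m))"

lemma idiv_coeff_0 [simp]: "idiv_coeff k a 0 = 1"
  by (simp add: idiv_coeff_def)

lemma idiv_coeff_Suc:
  "idiv_coeff k a (Suc l) = idiv_coeff k a l * (qint (2 * k + 2 * a - 2 * int l)
     * (qint (2 * a - 2 * int l) * qint (2 * k - 2 * int l)) / qint (2 * int l + 2))"
  by (simp add: idiv_coeff_def algebra_simps)

lemma prod_qint_shift:
  "(\<Prod>m=1..Suc l. qint (c - 2 * int m + 2)) = qint c * (\<Prod>m=1..l. qint (c - 2 * int m))"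
proof -
  have "(\<Prod>m=1..Suc l. qint (c - 2 * int m + 2)) = (\<Prod>m=0..l. qint (c - 2 * int m))"
    using prod.atLeast_Suc_atMost_Suc_shift[of "\<lambda>m. qint (c - 2 * int m + 2)" 0 l]
    by (simp add: algebra_simps)
  then show ?thesis
    by (simp add: prod.atLeast_Suc_atMost)
qed

text \<open>Raising \<open>k\<close> by one moves the two products that depend on \<open>k\<close>
  by one place, so they gain a new first factor; the product in \<open>a\<close> and the denominator
  gain a new last factor.\<close>

lemma idiv_coeff_shift:
  "idiv_coeff (k + 1) a (Suc l) = idiv_coeff k a l * (qint (2 * k + 2 * a + 2)
     * (qint (2 * a - 2 * int l) * qint (2 * k + 2)) / qint (2 * int l + 2))"
  using prod_qint_shift[of "2 * k + 2 * a + 2" l] prod_qint_shift[of "2 * k + 2" l]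
  by (simp add: idiv_coeff_def prod.distrib prod_dividef algebra_simps)

text \<open>All three terms share the factor \<open>idiv_coeff k a l\<close> times [2a-2l]/[2l+2].
  What remains is \<open>qint_mult_shift\<close> for 2k+2a+2 and 2k+2, shifted by 2l+2.\<close>

lemma idiv_coeff_rec:
  "idiv_coeff (k + 1) a (Suc l) = idiv_coeff k a (Suc l)
     + idiv_coeff k a l * (qint (2 * a - 2 * int l) * qint (4 * k + 2 * a - 2 * int l + 2))"
proof -
  have "qint (2 * k + 2 * a + 2) * qint (2 * k + 2)
      = qint (2 * k + 2 * a - 2 * int l) * qint (2 * k - 2 * int l)
        + qint (2 * int l + 2) * qint (4 * k + 2 * a - 2 * int l + 2)"
    using qint_mult_shift[of "2 * k + 2 * a + 2" "2 * k + 2" "2 * int l + 2"]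
    by (simp add: algebra_simps)
  then have "qint (2 * k + 2 * a + 2) * (qint (2 * a - 2 * int l) * qint (2 * k + 2))
      = qint (2 * k + 2 * a - 2 * int l) * (qint (2 * a - 2 * int l) * qint (2 * k - 2 * int l))
        + qint (2 * int l + 2) * (qint (2 * a - 2 * int l) * qint (4 * k + 2 * a - 2 * int l + 2))"
    by algebra
  moreover have "qint (2 * int l + 2) \<noteq> 0"
    by simp
  ultimately show ?thesis
    unfolding idiv_coeff_shift unfolding idiv_coeff_Suc
    by (simp only: add_divide_distrib distrib_left nonzero_mult_div_cancel_left not_False_eq_True)
qed

text \<open>The factor with m = k+1 contains [0]. This is what ends the expansion at l = k.\<close>

lemma idiv_coeff_eq_0:
  assumes "k < l"
  shows "idiv_coeff (int k) a l = 0"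
proof -
  have "qint (2 * int k - 2 * int (Suc k) + 2) = 0" "Suc k \<in> {1..l}"
    using assms by simp_all
  then show ?thesis
    unfolding idiv_coeff_def by (intro prod_zero bexI[of _ "Suc k"]) simp_all
qed

section \<open>Expansion of products of the \<open>P k\<close> in the subalgebra generated by
  B\<close>

lemma idiv_prod_0 [simp]: "idiv_prod \<sigma> 0 = 1"
  by (simp add: idiv_prod_def)

lemma idiv_prod_Suc:
  "idiv_prod \<sigma> (Suc n) = idiv_prod \<sigma> n * ((uB \<sigma>)\<^sup>2 - (q * \<sigma> * (qint (2 * int n + 1))\<^sup>2) *\<^sub>q 1)"
  by (simp add: idiv_prod_def algebra_simps)

lemma uB_idiv_prod_commute: "uB \<sigma> * idiv_prod \<sigma> n = idiv_prod \<sigma> n * uB \<sigma>"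
proof (induction n)
  case (Suc n)
  have "uB \<sigma> * ((uB \<sigma>)\<^sup>2 - c *\<^sub>q 1) = ((uB \<sigma>)\<^sup>2 - c *\<^sub>q 1) * uB \<sigma>" for c
    by (simp add: power2_eq_square right_diff_distrib left_diff_distrib mult.assoc
        uq_scale_mult_left uq_scale_mult_right)
  with Suc show ?case
    unfolding idiv_prod_Suc by (metis mult.assoc)
qed simp

lemma uB_square_idiv_prod_commute: "(uB \<sigma>)\<^sup>2 * idiv_prod \<sigma> n = idiv_prod \<sigma> n * (uB \<sigma>)\<^sup>2"
  by (metis mult.assoc power2_eq_square uB_idiv_prod_commute)

lemma idiv_prod_mult_uB_square:
  "idiv_prod \<sigma> n * (uB \<sigma>)\<^sup>2
     = idiv_prod \<sigma> (Suc n) + (q * \<sigma> * (qint (2 * int n + 1))\<^sup>2) *\<^sub>q idiv_prod \<sigma> n"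
  by (simp add: idiv_prod_Suc right_diff_distrib uq_scale_mult_right)

text \<open>Multiplying \<open>P n\<close> by B^2 leaves the remainder t[2n+1]^2; subtracting t[c]^2
  from it gives a difference of squares that factors.\<close>

lemma idiv_prod_mult_factor:
  "idiv_prod \<sigma> n * ((uB \<sigma>)\<^sup>2 - (q * \<sigma> * (qint c)\<^sup>2) *\<^sub>q 1)
     = idiv_prod \<sigma> (Suc n)
       + (q * \<sigma> * (qint (2 * int n + 1 - c) * qint (2 * int n + 1 + c))) *\<^sub>q idiv_prod \<sigma> n"
proof -
  have square: "q * \<sigma> * (qint (2 * int n + 1))\<^sup>2 = q * \<sigma> * (qint c)\<^sup>2
      + q * \<sigma> * (qint (2 * int n + 1 - c) * qint (2 * int n + 1 + c))"
    using qint_square_diff[of "2 * int n + 1" c] by algebra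
  show ?thesis
    unfolding right_diff_distrib uq_scale_mult_right idiv_prod_mult_uB_square square
      uq.scale_left_distrib
    by simp
qed

text \<open>Regroups a sum in which each term splits in two: \<open>f (Suc l)\<close> is to be
  merged with \<open>g l\<close>. In the applications the surplus \<open>f (Suc n)\<close> is
  zero.\<close>

lemma sum_absorb_shift:
  fixes g :: "nat \<Rightarrow> 'a::comm_monoid_add"
  shows "(\<Sum>l=0..n. f l + g l) + f (Suc n) = f 0 + (\<Sum>l=0..n. f (Suc l) + g l)"
proof -
  have "sum f {0..n} + f (Suc n) = f 0 + (\<Sum>l=0..n. f (Suc l))"
    using sum.atLeast0_atMost_Suc_shift[of f n] by simp
  then have "sum f {0..n} + f (Suc n) + sum g {0..n} = f 0 + (\<Sum>l=0..n. f (Suc l)) + sum g {0..n}"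
    by simp
  then show ?thesis
    by (simp only: sum.distrib ac_simps)
qed

lemma idiv_prod_mult:
  "idiv_prod \<sigma> k * idiv_prod \<sigma> a
     = (\<Sum>l=0..k. (idiv_coeff (int k) (int a) l * (q * \<sigma>) ^ l) *\<^sub>q idiv_prod \<sigma> (k + a - l))"
proof (induction k)
  case (Suc k)
  let ?x = "(uB \<sigma>)\<^sup>2 - (q * \<sigma> * (qint (2 * int k + 1))\<^sup>2) *\<^sub>q 1"
  let ?c = "\<lambda>l. idiv_coeff (int k) (int a) l * (q * \<sigma>) ^ l"
  let ?f = "\<lambda>l. ?c l *\<^sub>q idiv_prod \<sigma> (Suc k + a - l)"
  let ?g = "\<lambda>l. (?c l * (q * \<sigma> * (qint (2 * int a - 2 * int l)
      * qint (4 * int k + 2 * int a - 2 * int l + 2)))) *\<^sub>q idiv_prod \<sigma> (k + a - l)"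
  \<comment> \<open>The new factor is a polynomial in B, so it can be moved to the right past
    \<open>P a\<close>.\<close>
  have "idiv_prod \<sigma> (Suc k) * idiv_prod \<sigma> a = idiv_prod \<sigma> k * idiv_prod \<sigma> a * ?x"
    by (simp add: idiv_prod_Suc mult.assoc right_diff_distrib left_diff_distrib
        uB_square_idiv_prod_commute uq_scale_mult_left uq_scale_mult_right)
  also have "\<dots> = (\<Sum>l=0..k. ?c l *\<^sub>q (idiv_prod \<sigma> (k + a - l) * ?x))"
    by (simp add: Suc.IH sum_distrib_right uq_scale_mult_left)
  \<comment> \<open>\<open>idiv_prod_mult_factor\<close> with n = k+a-l and c = 2k+1 gives the
    arguments 2a-2l and 4k+2a-2l+2. In \<open>?f\<close> the index of P is raised, in
    \<open>?g\<close> a factor t is gained.\<close>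
  also have "\<dots> = (\<Sum>l=0..k. ?f l + ?g l)"
  proof (rule sum.cong[OF refl])
    fix l assume "l \<in> {0..k}"
    then have "l \<le> k" "Suc (k + a - l) = Suc k + a - l"
      by auto
    then show "?c l *\<^sub>q (idiv_prod \<sigma> (k + a - l) * ?x) = ?f l + ?g l"
      unfolding idiv_prod_mult_factor
      by (simp add: uq.scale_right_distrib of_nat_diff algebra_simps)
  qed
  \<comment> \<open>\<open>?f (Suc l)\<close> and \<open>?g l\<close> carry the same P and the same
    power of t, so \<open>idiv_coeff_rec\<close> can add their coefficients;
    \<open>?f (Suc k)\<close> vanishes.\<close>
  also have "\<dots> = ?f 0 + (\<Sum>l=0..k. ?f (Suc l) + ?g l)"
    using sum_absorb_shift[of ?f ?g k] by (simp add: idiv_coeff_eq_0)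
  also have "\<dots> = ?f 0 + (\<Sum>l=0..k. (idiv_coeff (int (Suc k)) (int a) (Suc l) * (q * \<sigma>) ^ Suc l)
      *\<^sub>q idiv_prod \<sigma> (Suc k + a - Suc l))"
    using idiv_coeff_rec[of "int k" "int a"]
    by (simp add: algebra_simps flip: uq.scale_left_distrib)
  also have "\<dots> = (\<Sum>l=0..Suc k. (idiv_coeff (int (Suc k)) (int a) l * (q * \<sigma>) ^ l)
      *\<^sub>q idiv_prod \<sigma> (Suc k + a - l))"
    by (simp only: sum.atLeast0_atMost_Suc_shift) simp
  finally show ?case .
qed simp

text \<open>Prepares the product of two odd divided powers, whose two factors B combine to B^2. The
  regrouping is that of \<open>idiv_prod_mult\<close>, but the full remainder t[2(k+a-l)+1]^2
  stays.\<close>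

lemma idiv_prod_mult_uB_square_expansion:
  "idiv_prod \<sigma> k * idiv_prod \<sigma> a * (uB \<sigma>)\<^sup>2 = idiv_prod \<sigma> (k + a + 1)
     + (\<Sum>l=0..k. ((idiv_coeff (int k) (int a) (Suc l) + idiv_coeff (int k) (int a) l
           * (qint (2 * int k + 2 * int a - 2 * int l + 1))\<^sup>2) * (q * \<sigma>) ^ Suc l)
         *\<^sub>q idiv_prod \<sigma> (k + a - l))"
proof -
  let ?c = "\<lambda>l. idiv_coeff (int k) (int a) l * (q * \<sigma>) ^ l"
  let ?f = "\<lambda>l. ?c l *\<^sub>q idiv_prod \<sigma> (Suc k + a - l)"
  let ?g = "\<lambda>l. (?c l * (q * \<sigma> * (qint (2 * int k + 2 * int a - 2 * int l + 1))\<^sup>2))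
      *\<^sub>q idiv_prod \<sigma> (k + a - l)"
  have "idiv_prod \<sigma> k * idiv_prod \<sigma> a * (uB \<sigma>)\<^sup>2
      = (\<Sum>l=0..k. ?c l *\<^sub>q (idiv_prod \<sigma> (k + a - l) * (uB \<sigma>)\<^sup>2))"
    by (simp add: idiv_prod_mult sum_distrib_right uq_scale_mult_left)
  also have "\<dots> = (\<Sum>l=0..k. ?f l + ?g l)"
  proof (rule sum.cong[OF refl])
    fix l assume "l \<in> {0..k}"
    then have "l \<le> k" "Suc (k + a - l) = Suc k + a - l"
      by auto
    then show "?c l *\<^sub>q (idiv_prod \<sigma> (k + a - l) * (uB \<sigma>)\<^sup>2) = ?f l + ?g l"
      unfolding idiv_prod_mult_uB_square
      by (simp add: uq.scale_right_distrib of_nat_diff algebra_simps)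
  qed
  also have "\<dots> = ?f 0 + (\<Sum>l=0..k. ?f (Suc l) + ?g l)"
    using sum_absorb_shift[of ?f ?g k] by (simp add: idiv_coeff_eq_0)
  finally show ?thesis
    by (simp add: algebra_simps flip: uq.scale_left_distrib)
qed

section \<open>From the products \<open>P k\<close> to divided powers: normalisation by
  factorials\<close>

lemma idiv_even: "idiv \<sigma> (2 * n) = inverse (qfact (2 * n)) *\<^sub>q idiv_prod \<sigma> n"
  by (simp add: idiv_def)

lemma idiv_odd: "idiv \<sigma> (2 * n + 1) = inverse (qfact (2 * n + 1)) *\<^sub>q (uB \<sigma> * idiv_prod \<sigma> n)"
  by (simp add: idiv_def)

lemma uq_scale_mult_scale: "(c *\<^sub>q x) * (d *\<^sub>q y) = (c * d) *\<^sub>q (x * y)"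
  by (simp only: uq_scale_mult_left uq_scale_mult_right uq.scale_scale mult.commute[of c])

text \<open>The leading term of each formula is its l = 0 term, where the empty product and the
  zeroth power of t give \<open>d 0 = 1\<close>.\<close>

lemma uq_scale_add_sum:
  fixes k :: nat
  assumes "d 0 = 1"
  shows "c *\<^sub>q (x 0 + (\<Sum>l=1..k. d l *\<^sub>q x l)) = (\<Sum>l=0..k. (c * d l) *\<^sub>q x l)"
  using sum.atLeast_Suc_atMost[of 0 k "\<lambda>l. (c * d l) *\<^sub>q x l"]
  by (simp add: assms uq.scale_sum_right uq.scale_right_distrib)

text \<open>Extending the fraction by [2n-2m+2] completes each odd denominator to a pair from
  \<open>qfact_double_diff\<close>. Odd arguments are never zero, and l \<le> n keeps the even ones
  positive.\<close>

lemma prod_div_odd_qint: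
  assumes "l \<le> n"
  shows "(\<Prod>m=1..l. x m / (qint (2 * int n - 2 * int m + 1) * y m))
     = (\<Prod>m=1..l. qint (2 * int n - 2 * int m + 2) * x m / y m)
       * (qfact (2 * n - 2 * l) / qfact (2 * n))"
proof -
  have "2 * int n - 2 * int m + 1 \<noteq> 0" for m
    by presburger
  then have odd: "(\<Prod>m=1..l. qint (2 * int n - 2 * int m + 1)) \<noteq> 0"
    by simp
  have even: "(\<Prod>m=1..l. qint (2 * int n - 2 * int m + 2)) \<noteq> 0"
    using assms by auto
  show ?thesis
    unfolding qfact_double_diff[OF assms] prod.distrib prod_dividef
    using odd even by (simp add: field_simps)
qed

text \<open>Here the odd factor lies above its even partner, so the pairs are those of
  [2n+1]!.\<close>

lemma prod_div_odd_qint_Suc: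
  assumes "l \<le> n"
  shows "(\<Prod>m=1..l. x m / (qint (2 * int n - 2 * int m + 3) * y m))
     = (\<Prod>m=1..l. qint (2 * int n - 2 * int m + 2) * x m / y m)
       * (qfact (2 * n + 1 - 2 * l) / qfact (2 * n + 1))"
proof -
  have "2 * int n - 2 * int m + 3 \<noteq> 0" for m
    by presburger
  then have odd: "(\<Prod>m=1..l. qint (2 * int n - 2 * int m + 3)) \<noteq> 0"
    by simp
  have even: "(\<Prod>m=1..l. qint (2 * int n - 2 * int m + 2)) \<noteq> 0"
    using assms by auto
  show ?thesis
    unfolding qfact_double_Suc_diff[OF assms] prod.distrib prod_dividef
    using odd even by (simp add: field_simps)
qed

section \<open>The three formulas with at least one even index\<close>

lemma idiv_even_mult_even:
  "idiv \<sigma> (2*k) * idiv \<sigma> (2*a) =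
      qbinom (2*k + 2*a) (2*k) *\<^sub>q (idiv \<sigma> (2*k + 2*a)
        + (\<Sum>l=1..k.
            ((\<Prod>m=1..l. (qint (2*int a - 2*int m + 2) * qint (2*int k - 2*int m + 2))
                      / (qint (2*int k + 2*int a - 2*int m + 1) * qint (2*int m)))
              * (q * \<sigma>) ^ l) *\<^sub>q idiv \<sigma> (2*k + 2*a - 2*l)))"
proof -
  let ?t = "q * \<sigma>"
  let ?d = "\<lambda>l. (\<Prod>m=1..l. (qint (2*int a - 2*int m + 2) * qint (2*int k - 2*int m + 2))
      / (qint (2*int k + 2*int a - 2*int m + 1) * qint (2*int m))) * ?t ^ l"
  let ?b = "qbinom (2*k + 2*a) (2*k)"
  \<comment> \<open>With n = k+a, the even factors used to extend the fraction are exactly the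
    leading factors in \<open>idiv_coeff\<close>.\<close>
  have coeff: "?d l = idiv_coeff (int k) (int a) l
      * (qfact (2*k + 2*a - 2*l) / qfact (2*k + 2*a)) * ?t ^ l" if "l \<le> k" for l
    using prod_div_odd_qint[of l "k + a" "\<lambda>m. qint (2*int a - 2*int m + 2) * qint (2*int k - 2*int m + 2)"
        "\<lambda>m. qint (2*int m)"] that
    by (simp add: idiv_coeff_def distrib_left)
  have "idiv \<sigma> (2*k) * idiv \<sigma> (2*a) = (\<Sum>l=0..k. (inverse (qfact (2*k)) * inverse (qfact (2*a))
      * (idiv_coeff (int k) (int a) l * ?t ^ l)) *\<^sub>q idiv_prod \<sigma> (k + a - l))"
    by (simp add: idiv_even idiv_prod_mult uq_scale_mult_left uq_scale_mult_right
        uq.scale_sum_right mult.assoc mult.left_commute)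
  also have "\<dots> = (\<Sum>l=0..k. (?b * ?d l) *\<^sub>q idiv \<sigma> (2*k + 2*a - 2*l))"
  proof (rule sum.cong[OF refl])
    fix l assume "l \<in> {0..k}"
    then have l: "l \<le> k"
      by simp
    have "idiv \<sigma> (2*k + 2*a - 2*l)
        = inverse (qfact (2*k + 2*a - 2*l)) *\<^sub>q idiv_prod \<sigma> (k + a - l)"
      using idiv_even[of \<sigma> "k + a - l"] by (simp add: algebra_simps)
    moreover have "inverse (qfact (2*k)) * inverse (qfact (2*a))
        * (idiv_coeff (int k) (int a) l * ?t ^ l) = ?b * ?d l * inverse (qfact (2*k + 2*a - 2*l))"
      unfolding coeff[OF l] by (simp add: qbinom_def field_simps)
    ultimately show "(inverse (qfact (2*k)) * inverse (qfact (2*a))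
        * (idiv_coeff (int k) (int a) l * ?t ^ l)) *\<^sub>q idiv_prod \<sigma> (k + a - l)
        = (?b * ?d l) *\<^sub>q idiv \<sigma> (2*k + 2*a - 2*l)"
      by (simp only: uq.scale_scale)
  qed
  also have "\<dots> = ?b *\<^sub>q (idiv \<sigma> (2*k + 2*a)
      + (\<Sum>l=1..k. ?d l *\<^sub>q idiv \<sigma> (2*k + 2*a - 2*l)))"
    using uq_scale_add_sum[of ?d ?b "\<lambda>l. idiv \<sigma> (2*k + 2*a - 2*l)" k] by simp
  finally show ?thesis .
qed

text \<open>Serves both formulas of mixed parity: they differ only in the normalisation
  \<open>c\<close>, which together with [2k+2a+1]! becomes the respective binomial.\<close>

lemma uB_mult_idiv_prod_mult:
  "c *\<^sub>q (uB \<sigma> * (idiv_prod \<sigma> k * idiv_prod \<sigma> a))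
     = (c * qfact (2*k + 2*a + 1)) *\<^sub>q (idiv \<sigma> (2*k + 2*a + 1)
        + (\<Sum>l=1..k.
            ((\<Prod>m=1..l. (qint (2*int a - 2*int m + 2) * qint (2*int k - 2*int m + 2))
                      / (qint (2*int k + 2*int a - 2*int m + 3) * qint (2*int m)))
              * (q * \<sigma>) ^ l) *\<^sub>q idiv \<sigma> (2*k + 2*a + 1 - 2*l)))"
proof -
  let ?t = "q * \<sigma>"
  let ?d = "\<lambda>l. (\<Prod>m=1..l. (qint (2*int a - 2*int m + 2) * qint (2*int k - 2*int m + 2))
      / (qint (2*int k + 2*int a - 2*int m + 3) * qint (2*int m))) * ?t ^ l"
  let ?b = "c * qfact (2*k + 2*a + 1)"
  have coeff: "?d l = idiv_coeff (int k) (int a) l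
      * (qfact (2*k + 2*a + 1 - 2*l) / qfact (2*k + 2*a + 1)) * ?t ^ l" if "l \<le> k" for l
    using prod_div_odd_qint_Suc[of l "k + a"
        "\<lambda>m. qint (2*int a - 2*int m + 2) * qint (2*int k - 2*int m + 2)"
        "\<lambda>m. qint (2*int m)"] that
    by (simp add: idiv_coeff_def distrib_left)
  have "c *\<^sub>q (uB \<sigma> * (idiv_prod \<sigma> k * idiv_prod \<sigma> a))
      = (\<Sum>l=0..k. (c * (idiv_coeff (int k) (int a) l * ?t ^ l))
          *\<^sub>q (uB \<sigma> * idiv_prod \<sigma> (k + a - l)))"
    by (simp add: idiv_prod_mult sum_distrib_left uq_scale_mult_right uq.scale_sum_right)
  also have "\<dots> = (\<Sum>l=0..k. (?b * ?d l) *\<^sub>q idiv \<sigma> (2*k + 2*a + 1 - 2*l))"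
  proof (rule sum.cong[OF refl])
    fix l assume "l \<in> {0..k}"
    then have l: "l \<le> k"
      by simp
    then have "2 * (k + a - l) + 1 = 2*k + 2*a + 1 - 2*l"
      by simp
    then have "idiv \<sigma> (2*k + 2*a + 1 - 2*l)
        = inverse (qfact (2*k + 2*a + 1 - 2*l)) *\<^sub>q (uB \<sigma> * idiv_prod \<sigma> (k + a - l))"
      by (metis idiv_odd)
    moreover have "c * (idiv_coeff (int k) (int a) l * ?t ^ l)
        = ?b * ?d l * inverse (qfact (2*k + 2*a + 1 - 2*l))"
      unfolding coeff[OF l] by (simp add: field_simps)
    ultimately show "(c * (idiv_coeff (int k) (int a) l * ?t ^ l))
        *\<^sub>q (uB \<sigma> * idiv_prod \<sigma> (k + a - l)) = (?b * ?d l) *\<^sub>q idiv \<sigma> (2*k + 2*a + 1 - 2*l)"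
      by (simp only: uq.scale_scale)
  qed
  also have "\<dots> = ?b *\<^sub>q (idiv \<sigma> (2*k + 2*a + 1)
      + (\<Sum>l=1..k. ?d l *\<^sub>q idiv \<sigma> (2*k + 2*a + 1 - 2*l)))"
    using uq_scale_add_sum[of ?d ?b "\<lambda>l. idiv \<sigma> (2*k + 2*a + 1 - 2*l)" k] by simp
  finally show ?thesis .
qed

lemma idiv_even_mult_odd:
  "idiv \<sigma> (2*k) * idiv \<sigma> (2*a + 1) =
      qbinom (2*k + 2*a + 1) (2*k) *\<^sub>q (idiv \<sigma> (2*k + 2*a + 1)
        + (\<Sum>l=1..k.
            ((\<Prod>m=1..l. (qint (2*int a - 2*int m + 2) * qint (2*int k - 2*int m + 2))
                      / (qint (2*int k + 2*int a - 2*int m + 3) * qint (2*int m)))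
              * (q * \<sigma>) ^ l) *\<^sub>q idiv \<sigma> (2*k + 2*a + 1 - 2*l)))"
proof -
  have "idiv_prod \<sigma> k * (uB \<sigma> * idiv_prod \<sigma> a) = uB \<sigma> * (idiv_prod \<sigma> k * idiv_prod \<sigma> a)"
    by (metis mult.assoc uB_idiv_prod_commute)
  then have "idiv \<sigma> (2*k) * idiv \<sigma> (2*a + 1)
      = (inverse (qfact (2*k)) * inverse (qfact (2*a + 1)))
        *\<^sub>q (uB \<sigma> * (idiv_prod \<sigma> k * idiv_prod \<sigma> a))"
    by (simp only: idiv_even idiv_odd uq_scale_mult_scale)
  moreover have "inverse (qfact (2*k)) * inverse (qfact (2*a + 1)) * qfact (2*k + 2*a + 1)
      = qbinom (2*k + 2*a + 1) (2*k)"
    by (simp add: qbinom_def field_simps)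
  ultimately show ?thesis
    by (simp only: uB_mult_idiv_prod_mult)
qed

lemma idiv_odd_mult_even:
  "idiv \<sigma> (2*k + 1) * idiv \<sigma> (2*a) =
      qbinom (2*k + 2*a + 1) (2*k + 1) *\<^sub>q (idiv \<sigma> (2*k + 2*a + 1)
        + (\<Sum>l=1..k.
            ((\<Prod>m=1..l. (qint (2*int a - 2*int m + 2) * qint (2*int k - 2*int m + 2))
                      / (qint (2*int k + 2*int a - 2*int m + 3) * qint (2*int m)))
              * (q * \<sigma>) ^ l) *\<^sub>q idiv \<sigma> (2*k + 2*a + 1 - 2*l)))"
proof -
  have "idiv \<sigma> (2*k + 1) * idiv \<sigma> (2*a)
      = (inverse (qfact (2*k + 1)) * inverse (qfact (2*a)))
        *\<^sub>q (uB \<sigma> * (idiv_prod \<sigma> k * idiv_prod \<sigma> a))"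
    by (simp only: idiv_even idiv_odd uq_scale_mult_scale mult.assoc)
  moreover have "inverse (qfact (2*k + 1)) * inverse (qfact (2*a)) * qfact (2*k + 2*a + 1)
      = qbinom (2*k + 2*a + 1) (2*k + 1)"
    by (simp add: qbinom_def field_simps)
  ultimately show ?thesis
    by (simp only: uB_mult_idiv_prod_mult)
qed

section \<open>The product of two divided powers of odd index\<close>

text \<open>This is \<open>idiv_coeff_shift\<close> without the factor [2a-2l]. Since that factor is
  zero for l = a, it is left out of the product from the start instead of being divided out.\<close>

lemma idiv_coeff_shift_cancelled:
  "(\<Prod>m=1..Suc l. qint (2 * k + 2 * a - 2 * int m + 4)
       * ((if m = Suc l then 1 else qint (2 * a - 2 * int m + 2)) * qint (2 * k - 2 * int m + 4))
       / qint (2 * int m))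
     = idiv_coeff k a l * (qint (2 * k + 2 * a + 2) * qint (2 * k + 2) / qint (2 * int l + 2))"
proof -
  have "(\<Prod>m=1..Suc l. if m = Suc l then 1 else qint (2 * a - 2 * int m + 2))
      = (\<Prod>m=1..l. qint (2 * a - 2 * int m + 2))"
    by (simp cong: prod.cong_simp)
  moreover have "(\<Prod>m=1..Suc l. qint (2 * k + 2 * a - 2 * int m + 4))
      = qint (2 * k + 2 * a + 2) * (\<Prod>m=1..l. qint (2 * k + 2 * a - 2 * int m + 2))"
    using prod_qint_shift[of "2 * k + 2 * a + 2" l] by (simp add: algebra_simps)
  moreover have "(\<Prod>m=1..Suc l. qint (2 * k - 2 * int m + 4))
      = qint (2 * k + 2) * (\<Prod>m=1..l. qint (2 * k - 2 * int m + 2))"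
    using prod_qint_shift[of "2 * k + 2" l] by (simp add: algebra_simps)
  moreover have "(\<Prod>m=1..Suc l. qint (2 * int m)) = (\<Prod>m=1..l. qint (2 * int m)) * qint (2 * int l + 2)"
    by (simp add: algebra_simps)
  ultimately show ?thesis
    unfolding idiv_coeff_def prod.distrib prod_dividef by simp
qed

text \<open>The two summands match separately: the first yields the coefficient at
  \<open>Suc l\<close>, the second the coefficient at \<open>l\<close> times the square coming from
  B^2.\<close>

lemma odd_mult_odd_coeff:
  assumes "l \<le> k"
  shows "(qint (2*int k + 2*int a - 2*int (Suc l) + 2) * qint (2*int k - 2*int (Suc l) + 2))
       / (qint (2*int k + 2*int a + 2) * qint (2*int k + 2))
       * (\<Prod>m=1..Suc l. (qint (2*int a - 2*int m + 2) * qint (2*int k - 2*int m + 4))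
            / (qint (2*int k + 2*int a - 2*int m + 3) * qint (2*int m)))
     + ((qint (2*int k + 2*int a - 2*int (Suc l) + 3))\<^sup>2 * qint (2*int (Suc l)))
       / (qint (2*int k + 2*int a + 2) * qint (2*int k + 2))
       * (\<Prod>m=1..Suc l. ((if m = Suc l then 1 else qint (2*int a - 2*int m + 2))
                * qint (2*int k - 2*int m + 4))
            / (qint (2*int k + 2*int a - 2*int m + 3) * qint (2*int m)))
     = (idiv_coeff (int k) (int a) (Suc l) + idiv_coeff (int k) (int a) l
          * (qint (2*int k + 2*int a - 2*int l + 1))\<^sup>2)
       * (qfact (2*k + 2*a - 2*l) / qfact (2*k + 2*a + 2))"
    (is "?u / ?w * ?P + ?v / ?w * ?Q = (?C' + ?C * ?s) * ?r")
proof -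
  \<comment> \<open>\<open>prod_div_odd_qint\<close> is used with n = k+a+1 and \<open>Suc l\<close>
    factors, which gives the denominators [2k+2a-2m+3] and the quotient \<open>?r\<close>.\<close>
  have l: "Suc l \<le> k + a + 1"
    using assms by simp
  have nonzero: "qint (2*int k + 2*int a + 2) \<noteq> 0" "qint (2*int k + 2) \<noteq> 0" "qint (2*int l + 2) \<noteq> 0"
    by simp_all
  have P: "?P = idiv_coeff (int k + 1) (int a) (Suc l) * ?r"
    using prod_div_odd_qint[OF l, of "\<lambda>m. qint (2*int a - 2*int m + 2) * qint (2*int k - 2*int m + 4)"
        "\<lambda>m. qint (2*int m)"]
    by (simp add: idiv_coeff_def algebra_simps)
  have u: "?u = qint (2*int k + 2*int a - 2*int l) * qint (2*int k - 2*int l)"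
    by (simp add: algebra_simps)
  \<comment> \<open>\<open>?u / ?w\<close> exchanges the factors [2k+2a+2][2k+2] of
    \<open>idiv_coeff_shift\<close> for the factors [2k+2a-2l][2k-2l] of
    \<open>idiv_coeff_Suc\<close>, which lowers k+1 back to k.\<close>
  have uP: "?u / ?w * ?P = ?C' * ?r"
    unfolding u P idiv_coeff_shift unfolding idiv_coeff_Suc using nonzero by simp
  have "?Q = ?C * (?w / qint (2*int l + 2)) * ?r"
    using prod_div_odd_qint[OF l, of "\<lambda>m. (if m = Suc l then 1 else qint (2*int a - 2*int m + 2))
          * qint (2*int k - 2*int m + 4)" "\<lambda>m. qint (2*int m)"]
      idiv_coeff_shift_cancelled[of "int k" "int a" l]
    by (simp add: algebra_simps)
  moreover have "?v = ?s * qint (2*int l + 2)"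
    by (simp add: algebra_simps)
  ultimately have "?v / ?w * ?Q = ?C * ?s * ?r"
    using nonzero by simp
  with uP show ?thesis
    by (simp only: distrib_right)
qed

lemma idiv_odd_mult_odd:
  "idiv \<sigma> (2*k + 1) * idiv \<sigma> (2*a + 1) =
      qbinom (2*k + 2*a + 2) (2*k + 1) *\<^sub>q (idiv \<sigma> (2*k + 2*a + 2)
        + (\<Sum>l=1..k+1.
            (( (qint (2*int k + 2*int a - 2*int l + 2) * qint (2*int k - 2*int l + 2))
                 / (qint (2*int k + 2*int a + 2) * qint (2*int k + 2))
               * (\<Prod>m=1..l. (qint (2*int a - 2*int m + 2) * qint (2*int k - 2*int m + 4))
                      / (qint (2*int k + 2*int a - 2*int m + 3) * qint (2*int m)))
             + ((qint (2*int k + 2*int a - 2*int l + 3))\<^sup>2 * qint (2*int l))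
                 / (qint (2*int k + 2*int a + 2) * qint (2*int k + 2))
               * (\<Prod>m=1..l. ((if m = l then 1 else qint (2*int a - 2*int m + 2))
                              * qint (2*int k - 2*int m + 4))
                      / (qint (2*int k + 2*int a - 2*int m + 3) * qint (2*int m))))
              * (q * \<sigma>) ^ l) *\<^sub>q idiv \<sigma> (2*k + 2*a + 2 - 2*l)))"
    (is "_ = ?b *\<^sub>q (_ + (\<Sum>l=1..k+1. (?d l * _ ^ l) *\<^sub>q _))")
proof -
  let ?t = "q * \<sigma>"
  let ?e = "\<lambda>l. idiv_coeff (int k) (int a) (Suc l) + idiv_coeff (int k) (int a) l
      * (qint (2*int k + 2*int a - 2*int l + 1))\<^sup>2"
  let ?i = "inverse (qfact (2*k + 1)) * inverse (qfact (2*a + 1))"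
  have b: "?b = ?i * qfact (2*k + 2*a + 2)"
    by (simp add: qbinom_def field_simps)
  \<comment> \<open>Both factors B are collected on the right, where the B^2 expansion
    applies.\<close>
  have "uB \<sigma> * idiv_prod \<sigma> k * (uB \<sigma> * idiv_prod \<sigma> a) = idiv_prod \<sigma> k * idiv_prod \<sigma> a * (uB \<sigma>)\<^sup>2"
    by (metis mult.assoc power2_eq_square uB_idiv_prod_commute)
  then have "idiv \<sigma> (2*k + 1) * idiv \<sigma> (2*a + 1)
      = ?i *\<^sub>q (idiv_prod \<sigma> k * idiv_prod \<sigma> a * (uB \<sigma>)\<^sup>2)"
    by (simp only: idiv_odd uq_scale_mult_scale)
  also have "\<dots> = ?i *\<^sub>q idiv_prod \<sigma> (k + a + 1)
      + (\<Sum>l=0..k. (?i * (?e l * ?t ^ Suc l)) *\<^sub>q idiv_prod \<sigma> (k + a - l))"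
    unfolding idiv_prod_mult_uB_square_expansion uq.scale_right_distrib uq.scale_sum_right
      uq.scale_scale ..
  also have "?i *\<^sub>q idiv_prod \<sigma> (k + a + 1) = ?b *\<^sub>q idiv \<sigma> (2*k + 2*a + 2)"
    using idiv_even[of \<sigma> "k + a + 1"] unfolding b by simp
  also have "(\<Sum>l=0..k. (?i * (?e l * ?t ^ Suc l)) *\<^sub>q idiv_prod \<sigma> (k + a - l))
      = (\<Sum>l=0..k. ?b *\<^sub>q ((?d (Suc l) * ?t ^ Suc l) *\<^sub>q idiv \<sigma> (2*k + 2*a + 2 - 2 * Suc l)))"
  proof (rule sum.cong[OF refl])
    fix l assume "l \<in> {0..k}"
    then have l: "l \<le> k"
      by simp
    have "idiv \<sigma> (2*k + 2*a + 2 - 2 * Suc l)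
        = inverse (qfact (2*k + 2*a - 2*l)) *\<^sub>q idiv_prod \<sigma> (k + a - l)"
      using idiv_even[of \<sigma> "k + a - l"] by (simp add: algebra_simps)
    moreover have "?i * (?e l * ?t ^ Suc l)
        = ?b * (?d (Suc l) * ?t ^ Suc l) * inverse (qfact (2*k + 2*a - 2*l))"
      unfolding b odd_mult_odd_coeff[OF l] by simp
    ultimately show "(?i * (?e l * ?t ^ Suc l)) *\<^sub>q idiv_prod \<sigma> (k + a - l)
        = ?b *\<^sub>q ((?d (Suc l) * ?t ^ Suc l) *\<^sub>q idiv \<sigma> (2*k + 2*a + 2 - 2 * Suc l))"
      by (simp only: uq.scale_scale mult.assoc)
  qed
  \<comment> \<open>Reindexing by one: the terms l = 0..k of the expansion carry t^(l+1), hence the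
    upper limit k+1.\<close>
  also have "\<dots> = ?b *\<^sub>q (\<Sum>l=1..k+1. (?d l * ?t ^ l) *\<^sub>q idiv \<sigma> (2*k + 2*a + 2 - 2*l))"
    using sum.shift_bounds_cl_Suc_ivl[of
        "\<lambda>l. (?d l * ?t ^ l) *\<^sub>q idiv \<sigma> (2*k + 2*a + 2 - 2*l)" 0 k]
    by (simp only: One_nat_def add_Suc_right add_0_right uq.scale_sum_right)
  finally show ?thesis
    by (simp only: uq.scale_right_distrib)
qed

theorem theorem3p1:
  fixes \<sigma> :: Qq and k a :: nat
  assumes "\<sigma> \<noteq> 0"
  shows
   "idiv \<sigma> (2*k) * idiv \<sigma> (2*a) =
      qbinom (2*k + 2*a) (2*k) *\<^sub>q (idiv \<sigma> (2*k + 2*a)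
        + (\<Sum>l=1..k.
            ((\<Prod>m=1..l. (qint (2*int a - 2*int m + 2) * qint (2*int k - 2*int m + 2))
                      / (qint (2*int k + 2*int a - 2*int m + 1) * qint (2*int m)))
              * (q * \<sigma>) ^ l) *\<^sub>q idiv \<sigma> (2*k + 2*a - 2*l)))
  \<and> idiv \<sigma> (2*k) * idiv \<sigma> (2*a + 1) =
      qbinom (2*k + 2*a + 1) (2*k) *\<^sub>q (idiv \<sigma> (2*k + 2*a + 1)
        + (\<Sum>l=1..k.
            ((\<Prod>m=1..l. (qint (2*int a - 2*int m + 2) * qint (2*int k - 2*int m + 2))
                      / (qint (2*int k + 2*int a - 2*int m + 3) * qint (2*int m)))
              * (q * \<sigma>) ^ l) *\<^sub>q idiv \<sigma> (2*k + 2*a + 1 - 2*l)))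
  \<and> idiv \<sigma> (2*k + 1) * idiv \<sigma> (2*a) =
      qbinom (2*k + 2*a + 1) (2*k + 1) *\<^sub>q (idiv \<sigma> (2*k + 2*a + 1)
        + (\<Sum>l=1..k.
            ((\<Prod>m=1..l. (qint (2*int a - 2*int m + 2) * qint (2*int k - 2*int m + 2))
                      / (qint (2*int k + 2*int a - 2*int m + 3) * qint (2*int m)))
              * (q * \<sigma>) ^ l) *\<^sub>q idiv \<sigma> (2*k + 2*a + 1 - 2*l)))
  \<and> idiv \<sigma> (2*k + 1) * idiv \<sigma> (2*a + 1) =
      qbinom (2*k + 2*a + 2) (2*k + 1) *\<^sub>q (idiv \<sigma> (2*k + 2*a + 2)
        + (\<Sum>l=1..k+1.
            (( (qint (2*int k + 2*int a - 2*int l + 2) * qint (2*int k - 2*int l + 2))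
                 / (qint (2*int k + 2*int a + 2) * qint (2*int k + 2))
               * (\<Prod>m=1..l. (qint (2*int a - 2*int m + 2) * qint (2*int k - 2*int m + 4))
                      / (qint (2*int k + 2*int a - 2*int m + 3) * qint (2*int m)))
             + ((qint (2*int k + 2*int a - 2*int l + 3))\<^sup>2 * qint (2*int l))
                 / (qint (2*int k + 2*int a + 2) * qint (2*int k + 2))
               * (\<Prod>m=1..l. ((if m = l then 1 else qint (2*int a - 2*int m + 2))
                              * qint (2*int k - 2*int m + 4))
                      / (qint (2*int k + 2*int a - 2*int m + 3) * qint (2*int m))))
              * (q * \<sigma>) ^ l) *\<^sub>q idiv \<sigma> (2*k + 2*a + 2 - 2*l)))"
  using idiv_even_mult_even[of \<sigma> k a] idiv_even_mult_odd[of \<sigma> k a]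
    idiv_odd_mult_even[of \<sigma> k a] idiv_odd_mult_odd[of \<sigma> k a]
  by (intro conjI)

end
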